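(* Let $G=(V,E)$ be a finite digraph with distinct vertices $s$ (source) and $t$ (sink) and capacities $c:E\to\mathbb{Z}_{\ge 0}$, and consider the network simplex algorithm for the maximum flow problem described in the context. Then the cycling phenomenon never occurs: there is no finite sequence of iterations of the algorithm (with any choices of entering and leaving edges) which starts at some feasible pseudo tree structure $(T,L,U)$ and returns to the same pseudo tree structure $(T,L,U)$ without the flow being updated (i.e. with the augmentation amount equal to $0$ in every iteration of the sequence).
   Context: A flow is a function $f:E\to\mathbb{R}$ with $0\le f(e)\le c(e)$ for all $e$ and flow conservation (inflow equals outflow) at every vertex other than $s,t$. Pseudo tree structure: let $A=(V_A,E_A)$, $B=(V_B,E_B)$ be trees in $G$ (ignoring directions) with $s\in V_A$, $t\in V_B$, $V_A\cup V_B=V$, $V_A\cap V_B=\emptyset$; put $T=E_A\cup E_B$ and split $E\setminus T$ into a disjoint union $L\cup U$. The triple $(T,L,U)$ determines a unique function $f$ with $f=0$ on $L$, $f=c$ on $U$, and values on $T$ fixed by conservation at vertices other than $s,t$; if $f$ is a flow, $(T,L,U)$ is a feasible pseudo tree structure with tree solution $f$. Let $L_{AB}=\{(u,v)\in L: u\in V_A, v\in V_B\}$ and $U_{BA}=\{(v,u)\in U: u\in V_A, v\in V_B\}$. Algorithm. Step 0: choose such trees $A,B$, set $T=E_A\cup E_B$, $L=E\setminus T$, $U=\emptyset$; the tree solution is the zero flow. Step 1: if $L_{AB}\cup U_{BA}=\emptyset$, stop (the current tree solution is output). Otherwise go to Step 2. Step 2: choose an entering edge $e\in L_{AB}\cup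 U_{BA}$ and add it to $T$; then $T\cup\{e\}$ contains a unique undirected $s$–$t$ path $P$ (containing $e$). Orient $P$ in the direction of $e$ if $e\in L_{AB}$ and opposite to $e$ if $e\in U_{BA}$. Augment $f$ along $P$ (increase $f$ on forward edges of $P$, decrease on backward edges, by the same amount $\delta\ge 0$) by the largest amount $\delta$ keeping $f$ a flow, so that at least one forward edge of $P$ reaches its capacity or one backward edge reaches $0$; choose one such edge $a$ of $P$ (the leaving edge). Step 3: set $T'=(T\cup\{e\})\setminus\{a\}$; $L'=(L\setminus\{e\})\cup\{a\}$ if $a$ reached the lower bound $0$, and $L'=L\setminus\{e\}$ if $a$ reached its capacity; $U'=E\setminus(T'\cup L')$. The new trees $A,B$ are the two components of $T'$ containing $s$ and $t$ respectively. Return to Step 1 with $(T',L',U')$. Cycling means returning, after finitely many iterations, to a previously visited pseudo tree structure without the tree solution having changed (degenerate iterations with $\delta=0$). *)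

theory Defs
  imports Complex_Main "Graph_Theory.Graph_Theory"
begin

text \<open>
  The digraph obtained by forgetting the directions of the arcs of \<open>H\<close>: every arc \<open>e\<close> gives rise to
  \<open>(e, True)\<close>, which traverses \<open>e\<close> forwards, and \<open>(e, False)\<close>, which traverses \<open>e\<close> backwards.
  Unlike the symmetric closure of \<open>H\<close>, this keeps the antiparallel arcs \<open>(u, v)\<close> and \<open>(v, u)\<close> apart.
\<close>
definition undirect :: "'a pair_pre_digraph \<Rightarrow> ('a, ('a \<times> 'a) \<times> bool) pre_digraph" where
  "undirect H =
    \<lparr> verts = pverts H, arcs = parcs H \<times> UNIV,
      tail = (\<lambda>(e, d). if d then fst e else snd e),
      head = (\<lambda>(e, d). if d then snd e else fst e) \<rparr>"

text \<open>
  \<^const>\<open>connected\<close> is weak connectivity. An undirected cycle uses each arc at most once, in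
  whichever direction; without this condition \<open>e\<close> followed by its reversal would be a cycle.
\<close>
definition undirected_tree :: "'a pair_pre_digraph \<Rightarrow> bool" where
  "undirected_tree H \<longleftrightarrow>
    connected (with_proj H) \<and>
    \<not> (\<exists>p. pre_digraph.cycle (undirect H) p \<and> distinct (map fst p))"

definition flow_conservation ::
  "'a pair_pre_digraph \<Rightarrow> 'a \<Rightarrow> 'a \<Rightarrow> ('a \<times> 'a \<Rightarrow> real) \<Rightarrow> bool" where
  "flow_conservation G s t f \<longleftrightarrow>
    (\<forall>v \<in> pverts G - {s, t}.
      (\<Sum>e \<in> in_arcs (with_proj G) v. f e) = (\<Sum>e \<in> out_arcs (with_proj G) v. f e))"

definition is_flow ::
  "'a pair_pre_digraph \<Rightarrow> 'a \<Rightarrow> 'a \<Rightarrow> ('a \<times> 'a \<Rightarrow> nat) \<Rightarrow> ('a \<times> 'a \<Rightarrow> real) \<Rightarrow> bool" where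
  "is_flow G s t c f \<longleftrightarrow>
    (\<forall>e \<in> parcs G. 0 \<le> f e \<and> f e \<le> real (c e)) \<and> flow_conservation G s t f"

definition tree_pair ::
  "'a pair_pre_digraph \<Rightarrow> 'a \<Rightarrow> 'a \<Rightarrow> 'a pair_pre_digraph \<Rightarrow> 'a pair_pre_digraph \<Rightarrow> bool" where
  "tree_pair G s t A B \<longleftrightarrow>
    subgraph (with_proj A) (with_proj G) \<and> subgraph (with_proj B) (with_proj G) \<and>
    undirected_tree A \<and> undirected_tree B \<and>
    s \<in> pverts A \<and> t \<in> pverts B \<and>
    pverts A \<union> pverts B = pverts G \<and> pverts A \<inter> pverts B = {}"

type_synonym 'a triple = "('a \<times> 'a) set \<times> ('a \<times> 'a) set \<times> ('a \<times> 'a) set"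

fun pseudo_tree_structure :: "'a pair_pre_digraph \<Rightarrow> 'a \<Rightarrow> 'a \<Rightarrow> 'a triple \<Rightarrow> bool" where
  "pseudo_tree_structure G s t (T, L, U) \<longleftrightarrow>
    (\<exists>A B. tree_pair G s t A B \<and> T = parcs A \<union> parcs B) \<and>
    L \<union> U = parcs G - T \<and> L \<inter> U = {}"

text \<open>The values of \<open>f\<close> outside \<open>parcs G\<close> are irrelevant.\<close>
fun tree_solution ::
  "'a pair_pre_digraph \<Rightarrow> 'a \<Rightarrow> 'a \<Rightarrow> ('a \<times> 'a \<Rightarrow> nat) \<Rightarrow> 'a triple \<Rightarrow> ('a \<times> 'a \<Rightarrow> real) \<Rightarrow> bool"
where
  "tree_solution G s t c (T, L, U) f \<longleftrightarrow>
    (\<forall>e \<in> L. f e = 0) \<and> (\<forall>e \<in> U. f e = real (c e)) \<and> flow_conservation G s t f"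

definition feasible_pseudo_tree_structure ::
  "'a pair_pre_digraph \<Rightarrow> 'a \<Rightarrow> 'a \<Rightarrow> ('a \<times> 'a \<Rightarrow> nat) \<Rightarrow> 'a triple \<Rightarrow> bool" where
  "feasible_pseudo_tree_structure G s t c X \<longleftrightarrow>
    pseudo_tree_structure G s t X \<and> (\<exists>f. tree_solution G s t c X f \<and> is_flow G s t c f)"

definition L_AB :: "'a pair_pre_digraph \<Rightarrow> 'a pair_pre_digraph \<Rightarrow> ('a \<times> 'a) set \<Rightarrow> ('a \<times> 'a) set" where
  "L_AB A B L = {(u, v) \<in> L. u \<in> pverts A \<and> v \<in> pverts B}"

definition U_BA :: "'a pair_pre_digraph \<Rightarrow> 'a pair_pre_digraph \<Rightarrow> ('a \<times> 'a) set \<Rightarrow> ('a \<times> 'a) set" where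
  "U_BA A B U = {(v, u) \<in> U. u \<in> pverts A \<and> v \<in> pverts B}"

text \<open>\<open>P\<close> is an oriented path, listed with the direction in which each arc is traversed.\<close>
definition augment ::
  "('a \<times> 'a \<Rightarrow> real) \<Rightarrow> (('a \<times> 'a) \<times> bool) list \<Rightarrow> real \<Rightarrow> 'a \<times> 'a \<Rightarrow> real" where
  "augment f P \<delta> e =
    (if (e, True) \<in> set P then f e + \<delta> else if (e, False) \<in> set P then f e - \<delta> else f e)"

definition max_augmentation ::
  "'a pair_pre_digraph \<Rightarrow> 'a \<Rightarrow> 'a \<Rightarrow> ('a \<times> 'a \<Rightarrow> nat) \<Rightarrow> ('a \<times> 'a \<Rightarrow> real) \<Rightarrow>
    (('a \<times> 'a) \<times> bool) list \<Rightarrow> real \<Rightarrow> bool" where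
  "max_augmentation G s t c f P \<delta> \<longleftrightarrow>
    0 \<le> \<delta> \<and> is_flow G s t c (augment f P \<delta>) \<and>
    (\<forall>\<delta>'. 0 \<le> \<delta>' \<and> is_flow G s t c (augment f P \<delta>') \<longrightarrow> \<delta>' \<le> \<delta>)"

text \<open>
  The undirected \<open>s\<close>-\<open>t\<close> path in \<open>T \<union> {e}\<close>, oriented so that \<open>e\<close> is a forward arc if \<open>fwd\<close> holds and
  a backward arc otherwise.
\<close>
definition augmenting_path ::
  "'a pair_pre_digraph \<Rightarrow> 'a \<Rightarrow> 'a \<Rightarrow> ('a \<times> 'a) set \<Rightarrow> 'a \<times> 'a \<Rightarrow> bool \<Rightarrow>
    (('a \<times> 'a) \<times> bool) list \<Rightarrow> bool" where
  "augmenting_path G s t T e fwd P \<longleftrightarrow>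
    (let H = undirect \<lparr> pverts = pverts G, parcs = T \<union> {e} \<rparr>
     in pre_digraph.apath H s P t \<or> pre_digraph.apath H t P s) \<and>
    (e, fwd) \<in> set P"

text \<open>
  One pass through the algorithm from \<open>(T, L, U)\<close> to \<open>(T', L', U')\<close> with augmentation amount \<open>\<delta>\<close>.
  The trees \<open>A\<close> and \<open>B\<close> are determined by \<open>T\<close>, being the components of \<open>s\<close> and \<open>t\<close> in it.
  A leaving arc that is forward on \<open>P\<close> leaves at its capacity, a backward one at \<open>0\<close>; for arcs of
  capacity \<open>0\<close> it is the direction on \<open>P\<close> that decides between the two bounds.
\<close>
fun iteration ::
  "'a pair_pre_digraph \<Rightarrow> 'a \<Rightarrow> 'a \<Rightarrow> ('a \<times> 'a \<Rightarrow> nat) \<Rightarrow> 'a triple \<Rightarrow> real \<Rightarrow> 'a triple \<Rightarrow> bool"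
where
  "iteration G s t c (T, L, U) \<delta> (T', L', U') \<longleftrightarrow>
    feasible_pseudo_tree_structure G s t c (T, L, U) \<and>
    (\<exists>A B f e P a.
      tree_pair G s t A B \<and> T = parcs A \<union> parcs B \<and>
      tree_solution G s t c (T, L, U) f \<and>
      e \<in> L_AB A B L \<union> U_BA A B U \<and>
      augmenting_path G s t T e (e \<in> L_AB A B L) P \<and>
      max_augmentation G s t c f P \<delta> \<and>
      ((a, True) \<in> set P \<and> augment f P \<delta> a = real (c a) \<and> L' = L - {e} \<or>
       (a, False) \<in> set P \<and> augment f P \<delta> a = 0 \<and> L' = (L - {e}) \<union> {a}) \<and>
      T' = (T \<union> {e}) - {a} \<and>
      U' = parcs G - (T' \<union> L'))"

end

theory Submission
  imports Defs
begin

text \<open>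
  Along a degenerate cycle, let \<open>K\<close> be the set of arcs that lie in every tree part \<open>T\<close>, and let \<open>C\<close>
  be the component of \<open>s\<close> in \<open>K\<close>, so that \<open>C \<subseteq> V\<^sub>A\<close> at all times. The oriented path \<open>P\<close> traverses the
  leaving arc from the new \<open>V\<^sub>A\<close> to the new \<open>V\<^sub>B\<close>, so that arc could only be used again in the direction
  opposite to this one, after its end in \<open>V\<^sub>A\<close> has moved to \<open>V\<^sub>B\<close>. If this end lies in \<open>C\<close> that never
  happens, and then the arc cannot return to its former state. Hence no leaving arc has exactly one
  end in \<open>C\<close>. So an arc of some \<open>T\<close> with exactly one end in \<open>C\<close> would stay in \<open>T\<close> for ever and belong to
  \<open>K\<close>, which is absurd. Therefore \<open>V\<^sub>A = C\<close> throughout; but an entering arc joins \<open>V\<^sub>A\<close> to \<open>V\<^sub>B\<close> and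
  either leaves at once or ends up in \<open>T\<close>, a contradiction.
\<close>

section \<open>Components of arc sets with directions forgotten\<close>

definition ucomponent :: "('a \<times> 'a) set \<Rightarrow> 'a \<Rightarrow> 'a set" where
  "ucomponent T u = (T \<union> T\<inverse>)\<^sup>* `` {u}"

lemma ucomponent_refl: "u \<in> ucomponent T u"
  by (simp add: ucomponent_def)

lemma ucomponent_mono: "T \<subseteq> T' \<Longrightarrow> ucomponent T u \<subseteq> ucomponent T' u"
  unfolding ucomponent_def by (intro Image_mono rtrancl_mono) auto

lemma ucomponent_step:
  assumes "e \<in> T"
  shows "fst e \<in> ucomponent T u \<longleftrightarrow> snd e \<in> ucomponent T u"
proof -
  have "(fst e, snd e) \<in> T \<union> T\<inverse>" "(snd e, fst e) \<in> T \<union> T\<inverse>" using assms by auto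
  then show ?thesis unfolding ucomponent_def by (auto intro: rtrancl_into_rtrancl)
qed

lemma ucomponent_subset:
  assumes "u \<in> S" and "\<And>e. e \<in> T \<Longrightarrow> fst e \<in> S \<longleftrightarrow> snd e \<in> S"
  shows "ucomponent T u \<subseteq> S"
proof
  fix v assume "v \<in> ucomponent T u"
  then have "(u, v) \<in> (T \<union> T\<inverse>)\<^sup>*" by (simp add: ucomponent_def)
  then show "v \<in> S" by induction (use assms in fastforce)+
qed

lemma ucomponent_sym: "v \<in> ucomponent T u \<Longrightarrow> u \<in> ucomponent T v"
  by (auto simp: ucomponent_def intro: symD[OF sym_rtrancl[OF sym_Un_converse]])

lemma ucomponent_trans:
  "v \<in> ucomponent T u \<Longrightarrow> w \<in> ucomponent T v \<Longrightarrow> w \<in> ucomponent T u"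
  by (auto simp: ucomponent_def)

section \<open>Paths that may traverse arcs backwards\<close>

lemma undirect_simps [simp]:
  "verts (undirect H) = pverts H" "arcs (undirect H) = parcs H \<times> UNIV"
  "tail (undirect H) (e, d) = (if d then fst e else snd e)"
  "head (undirect H) (e, d) = (if d then snd e else fst e)"
  by (simp_all add: undirect_def)

lemma wf_digraph_undirect:
  assumes "parcs H \<subseteq> pverts H \<times> pverts H"
  shows "wf_digraph (undirect H)"
  using assms by unfold_locales auto

lemma cas_undirect_ucomponent:
  assumes "pre_digraph.cas (undirect H) u p v" and "fst ` set p \<subseteq> T"
  shows "v \<in> ucomponent T u"
  using assms
proof (induction p arbitrary: u)
  case Nil
  then show ?case by (simp add: pre_digraph.cas.simps ucomponent_refl)
next
  case (Cons x p)
  obtain a d where x: "x = (a, d)" by fastforce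
  have "u = tail (undirect H) x" and w: "v \<in> ucomponent T (head (undirect H) x)"
    using Cons by (auto simp: pre_digraph.cas.simps)
  then have "head (undirect H) x \<in> ucomponent T u"
    using ucomponent_step[of a T u] ucomponent_refl[of u T] Cons.prems(2)
    by (auto simp: x split: if_splits)
  then show ?case using w by (rule ucomponent_trans)
qed

text \<open>A simple path visits each vertex once, so its stretch before \<open>a\<close> misses the
  head and its stretch after \<open>a\<close> misses the tail of the traversed arc; hence neither
  uses \<open>a\<close> again in either direction. Applied to the leaving arc, this locates its ends
  relative to the new trees.\<close>

lemma apath_undirect_avoid_arc:
  assumes wf: "parcs H \<subseteq> pverts H \<times> pverts H"
    and path: "pre_digraph.apath (undirect H) u p v" and a: "(a, d) \<in> set p"
  shows "tail (undirect H) (a, d) \<in> ucomponent (parcs H - {a}) u"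
    and "v \<in> ucomponent (parcs H - {a}) (head (undirect H) (a, d))"
proof -
  interpret wf_digraph "undirect H" using wf by (rule wf_digraph_undirect)
  obtain q r where p: "p = q @ (a, d) # r" using a by (meson split_list)
  let ?w = "tail (undirect H) (a, d)" and ?h = "head (undirect H) (a, d)"
  have q: "awalk u q ?w" and r: "awalk ?h r v"
    and dq: "set (awalk_verts u q) \<inter> set (awalk_verts ?h r) = {}"
    and dr: "?w \<notin> set (awalk_verts ?h r)"
    using path unfolding p apath_append_iff
    by (auto simp: apath_Cons_iff apath_def awalk_Cons_iff)
  have "?h \<in> set (awalk_verts ?h r)" by (cases r) (use r in \<open>auto simp: awalk_simps\<close>)
  then have hq: "?h \<notin> set (awalk_verts u q)" using dq by blast
  have "(a, d') \<notin> set q" for d'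
    using hq awalk_verts_arc1[of "(a, d')" q u] awalk_verts_arc2[OF q, of "(a, d')"]
    by (cases d; cases d') auto
  moreover have "set q \<subseteq> parcs H \<times> UNIV" using q by (simp add: awalk_def)
  ultimately have "fst ` set q \<subseteq> parcs H - {a}" by auto
  then show "?w \<in> ucomponent (parcs H - {a}) u"
    using q by (intro cas_undirect_ucomponent) (auto simp: awalk_def)
  have "(a, d') \<notin> set r" for d'
    using dr awalk_verts_arc1[of "(a, d')" r ?h] awalk_verts_arc2[OF r, of "(a, d')"]
    by (cases d; cases d') auto
  moreover have "set r \<subseteq> parcs H \<times> UNIV" using r by (simp add: awalk_def)
  ultimately have "fst ` set r \<subseteq> parcs H - {a}" by auto
  then show "v \<in> ucomponent (parcs H - {a}) ?h"
    using r by (intro cas_undirect_ucomponent) (auto simp: awalk_def)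
qed

section \<open>Recovering the trees from \<open>T\<close>\<close>

lemma tree_pair_arcs:
  assumes "tree_pair G s t A B" and "e \<in> parcs A \<union> parcs B"
  shows "e \<in> parcs G" and "fst e \<in> pverts G" and "snd e \<in> pverts G"
    and "fst e \<in> pverts A \<longleftrightarrow> snd e \<in> pverts A"
proof -
  have sub: "subgraph (with_proj A) (with_proj G)" "subgraph (with_proj B) (with_proj G)"
    and disj: "pverts A \<inter> pverts B = {}" and un: "pverts A \<union> pverts B = pverts G"
    using assms(1) by (auto simp: tree_pair_def)
  have wf: "pair_wf_digraph A" "pair_wf_digraph B"
    using sub by (auto simp: subgraph_def wf_digraph_wp_iff)
  show "e \<in> parcs G" using sub assms(2) by (auto simp: subgraph_def)
  have "fst e \<in> pverts A \<and> snd e \<in> pverts A \<or> fst e \<in> pverts B \<and> snd e \<in> pverts B"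
    using wf assms(2)
    by (auto simp: pair_wf_digraph.arc_fst_in_verts pair_wf_digraph.arc_snd_in_verts)
  then show "fst e \<in> pverts G" "snd e \<in> pverts G" "fst e \<in> pverts A \<longleftrightarrow> snd e \<in> pverts A"
    using disj un by auto
qed

text \<open>\<open>A\<close> is connected and no arc of either tree joins \<open>A\<close> to
  \<open>B\<close>; thus the vertex set of \<open>A\<close> depends on \<open>T\<close>
  alone.\<close>

lemma tree_pair_ucomponent:
  assumes "tree_pair G s t A B"
  shows "ucomponent (parcs A \<union> parcs B) s = pverts A"
proof
  show "ucomponent (parcs A \<union> parcs B) s \<subseteq> pverts A"
    using assms tree_pair_arcs(4)[OF assms]
    by (intro ucomponent_subset) (auto simp: tree_pair_def)
  show "pverts A \<subseteq> ucomponent (parcs A \<union> parcs B) s"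
  proof
    fix v assume v: "v \<in> pverts A"
    have conn: "connected (with_proj A)" and sA: "s \<in> pverts A"
      using assms by (auto simp: tree_pair_def undirected_tree_def)
    have "s \<rightarrow>\<^sup>*\<^bsub>with_proj (mk_symmetric (with_proj A))\<^esub> v"
      using conn sA v by (auto simp: connected_def strongly_connected_def)
    then have "(s, v) \<in> (parcs (mk_symmetric (with_proj A)))\<^sup>*"
      using reachable_rtranclI by fastforce
    moreover have "parcs (mk_symmetric (with_proj A)) \<subseteq> parcs A \<union> (parcs A)\<inverse>"
      by (auto simp: parcs_mk_symmetric)
    ultimately have "v \<in> ucomponent (parcs A) s"
      unfolding ucomponent_def using rtrancl_mono by blast
    then show "v \<in> ucomponent (parcs A \<union> parcs B) s"
      using ucomponent_mono[of "parcs A" "parcs A \<union> parcs B" s] by blast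
  qed
qed

lemma sink_notin_ucomponent:
  assumes "pseudo_tree_structure G s t (T, L, U)"
  shows "t \<notin> ucomponent T s"
  using assms by (auto simp: tree_pair_ucomponent) (auto simp: tree_pair_def)

section \<open>Exchange of arcs in one iteration\<close>

text \<open>
  A nonbasic arc can carry more flow along its own direction if it is in \<open>L\<close> and against it if it is in
  \<open>U\<close>. \<open>residual_crossing L U S e\<close> says that this direction leads from \<open>S\<close> to its complement.
\<close>
definition residual_crossing ::
  "('a \<times> 'a) set \<Rightarrow> ('a \<times> 'a) set \<Rightarrow> 'a set \<Rightarrow> 'a \<times> 'a \<Rightarrow> bool" where
  "residual_crossing L U S e \<longleftrightarrow>
    e \<in> L \<and> fst e \<in> S \<and> snd e \<notin> S \<or> e \<in> U \<and> fst e \<notin> S \<and> snd e \<in> S"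

text \<open>Extracts what the cycle argument uses. \<open>U'\<close> and \<open>L'\<close> trade
  places in the condition on \<open>a\<close> because \<open>P\<close> traverses \<open>a\<close>
  out of the new component of \<open>s\<close>, and at the bound where it leaves only the opposite
  direction is residual. The case \<open>a = e\<close> is included.\<close>

lemma iteration_exchange:
  assumes iter: "iteration G s t c (T, L, U) \<delta> (T', L', U')"
    and next_pts: "pseudo_tree_structure G s t (T', L', U')"
    and wfG: "pair_fin_digraph G"
  obtains e a where "T' = insert e T - {a}" "a \<in> insert e T"
    "residual_crossing L U (ucomponent T s) e"
    "residual_crossing U' L' (ucomponent T' s) a"
    "L - {e, a} \<subseteq> L'" "U - {e, a} \<subseteq> U'"
proof -
  from iter obtain A B f e P a where tp: "tree_pair G s t A B" and T: "T = parcs A \<union> parcs B"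
    and e: "e \<in> L_AB A B L \<union> U_BA A B U"
    and path: "augmenting_path G s t T e (e \<in> L_AB A B L) P"
    and a': "(a, True) \<in> set P \<and> augment f P \<delta> a = real (c a) \<and> L' = L - {e} \<or>
      (a, False) \<in> set P \<and> augment f P \<delta> a = 0 \<and> L' = (L - {e}) \<union> {a}"
    and T': "T' = (T \<union> {e}) - {a}" and U': "U' = parcs G - (T' \<union> L')"
    unfolding iteration.simps by (elim conjE exE)
  have a: "(a, True) \<in> set P \<and> L' = L - {e} \<or> (a, False) \<in> set P \<and> L' = (L - {e}) \<union> {a}"
    using a' by blast
  have LU: "L \<union> U = parcs G - T" "L \<inter> U = {}"
    using iter by (auto simp: feasible_pseudo_tree_structure_def)
  interpret pair_fin_digraph G by fact
  let ?S = "ucomponent T s" and ?S' = "ucomponent T' s"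
  have S: "?S = pverts A" unfolding T using tp by (rule tree_pair_ucomponent)
  have disj: "pverts A \<inter> pverts B = {}" and tB: "t \<in> pverts B" using tp by (auto simp: tree_pair_def)
  have eT: "e \<notin> T" and eG: "e \<in> parcs G" using e LU by (auto simp: L_AB_def U_BA_def)
  have e_cross: "residual_crossing L U ?S e"
    using e disj by (auto simp: residual_crossing_def S L_AB_def U_BA_def)
  have t_out: "t \<notin> ?S" "t \<notin> ?S'"
    using sink_notin_ucomponent[OF next_pts] disj tB by (auto simp: S)
  define H where "H = \<lparr>pverts = pverts G, parcs = T \<union> {e}\<rparr>"
  have H: "parcs H = T \<union> {e}" by (simp add: H_def)
  have wfH: "parcs H \<subseteq> pverts H \<times> pverts H"
  proof
    fix x assume "x \<in> parcs H"
    then have "fst x \<in> pverts G \<and> snd x \<in> pverts G"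
      using tree_pair_arcs(2,3)[OF tp, of x] eG
      by (auto simp: H T arc_fst_in_verts arc_snd_in_verts)
    then show "x \<in> pverts H \<times> pverts H" by (cases x) (simp add: H_def)
  qed
  have P: "pre_digraph.apath (undirect H) s P t \<or> pre_digraph.apath (undirect H) t P s"
    and eP: "(e, e \<in> L_AB A B L) \<in> set P"
    using path by (auto simp: augmenting_path_def H_def Let_def)
  \<comment> \<open>On a path from \<open>t\<close>, the stretch before \<open>e\<close> would lie
    in \<open>T\<close> and join \<open>t\<close> to the tail of the oriented \<open>e\<close>,
    which belongs to \<open>A\<close>.\<close>
  have "\<not> pre_digraph.apath (undirect H) t P s"
  proof
    assume "pre_digraph.apath (undirect H) t P s"
    from apath_undirect_avoid_arc(1)[OF wfH this eP]
    have "tail (undirect H) (e, e \<in> L_AB A B L) \<in> ucomponent T t"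
      using eT by (simp add: H)
    moreover have "tail (undirect H) (e, e \<in> L_AB A B L) \<in> ?S"
      using e by (auto simp: S L_AB_def U_BA_def)
    ultimately show False using t_out ucomponent_sym ucomponent_trans by metis
  qed
  then have P: "pre_digraph.apath (undirect H) s P t" using P by blast
  have T'_H: "parcs H - {a} = T'" by (simp add: H T')
  \<comment> \<open>Both stretches of \<open>P\<close> around \<open>a\<close> survive in
    \<open>T'\<close>; the second ends in \<open>t\<close>, so it cannot start in the component of
    \<open>s\<close>.\<close>
  have along: "tail (undirect H) (a, d) \<in> ?S'" "head (undirect H) (a, d) \<notin> ?S'"
    if "(a, d) \<in> set P" for d
  proof -
    note ends = apath_undirect_avoid_arc[OF wfH P that, unfolded T'_H]
    show "tail (undirect H) (a, d) \<in> ?S'" by (fact ends(1))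
    show "head (undirect H) (a, d) \<notin> ?S'" using ends(2) t_out(2) ucomponent_trans by metis
  qed
  interpret uH: wf_digraph "undirect H" using wfH by (rule wf_digraph_undirect)
  have aT: "a \<in> insert e T"
    using a P by (auto simp: uH.apath_def uH.awalk_def H)
  then have aG: "a \<in> parcs G" using eG tree_pair_arcs(1)[OF tp, of a] T by auto
  \<comment> \<open>An arc leaving at capacity lies in \<open>insert e T\<close>, hence not in
    \<open>L - {e}\<close>, and falls into \<open>U'\<close> by complement.\<close>
  from a have "a \<notin> L' \<and> (a, True) \<in> set P \<or> a \<in> L' \<and> (a, False) \<in> set P"
    using aT LU T eT by auto
  then have a_cross: "residual_crossing U' L' ?S' a"
    using along[of True] along[of False] aG by (auto simp: residual_crossing_def U' T')
  have "L - {e, a} \<subseteq> L'" "U - {e, a} \<subseteq> U'"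
    using a LU unfolding U' T' by auto
  then show thesis using that aT e_cross a_cross T' by auto
qed

section \<open>Absence of degenerate cycles\<close>

theorem theorem1:
  fixes G :: "'a pair_pre_digraph" and s t :: 'a and c :: "'a \<times> 'a \<Rightarrow> nat"
  assumes "pair_fin_digraph G"
    and "s \<in> pverts G" and "t \<in> pverts G" and "s \<noteq> t"
  shows "\<not> (\<exists>(n::nat) (X :: nat \<Rightarrow> 'a triple).
            n \<ge> 1 \<and>
            feasible_pseudo_tree_structure G s t c (X 0) \<and>
            (\<forall>i<n. iteration G s t c (X i) 0 (X (Suc i))) \<and>
            X n = X 0)"
proof (intro notI, elim exE conjE)
  fix n :: nat and X :: "nat \<Rightarrow> 'a triple"
  assume n: "n \<ge> 1" and X: "\<forall>i<n. iteration G s t c (X i) 0 (X (Suc i))" and Xn: "X n = X 0"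
  \<comment> \<open>The cycle is repeated for ever, so that no iteration is the last.\<close>
  define Y where "Y i = X (i mod n)" for i
  define T where "T i = fst (Y i)" for i
  define L where "L i = fst (snd (Y i))" for i
  define U where "U i = snd (snd (Y i))" for i
  define S where "S i = ucomponent (T i) s" for i
  have Y: "Y i = (T i, L i, U i)" for i by (simp add: T_def L_def U_def)
  have iter: "iteration G s t c (Y i) 0 (Y (Suc i))" for i
  proof -
    have "Y (Suc i) = X (Suc (i mod n))" using Xn by (simp add: Y_def mod_Suc)
    then show ?thesis using X n by (simp add: Y_def)
  qed
  have pts: "pseudo_tree_structure G s t (T i, L i, U i)" for i
    using iter[of i] unfolding Y[of i]
    by (cases "Y (Suc i)") (simp add: feasible_pseudo_tree_structure_def)
  have disj: "T i \<inter> L i = {}" "T i \<inter> U i = {}" "L i \<inter> U i = {}" for i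
    using pts[of i] by auto
  define exchange where "exchange i e a \<longleftrightarrow>
      T (Suc i) = insert e (T i) - {a} \<and> a \<in> insert e (T i) \<and>
      residual_crossing (L i) (U i) (S i) e \<and>
      residual_crossing (U (Suc i)) (L (Suc i)) (S (Suc i)) a \<and>
      L i - {e, a} \<subseteq> L (Suc i) \<and> U i - {e, a} \<subseteq> U (Suc i)" for i e a
  have "\<exists>e a. exchange i e a" for i
    unfolding exchange_def S_def
    by (rule iteration_exchange[OF iter[of i, unfolded Y] pts assms(1)]) blast
  then obtain e a where ea: "exchange i (e i) (a i)" for i by metis
  have T_Suc: "T (Suc i) = insert (e i) (T i) - {a i}"
    and a: "a i \<in> insert (e i) (T i)"
    and e_cross: "residual_crossing (L i) (U i) (S i) (e i)"
    and a_cross: "residual_crossing (U (Suc i)) (L (Suc i)) (S (Suc i)) (a i)"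
    and L_Suc: "L i - {e i, a i} \<subseteq> L (Suc i)"
    and U_Suc: "U i - {e i, a i} \<subseteq> U (Suc i)" for i
    using ea[of i] by (simp_all only: exchange_def)
  have period: "Y (i + k * n) = Y i" for i k by (simp add: Y_def)
  \<comment> \<open>Each structure recurs after any given index, so a property preserved by every
    iteration also holds at earlier indices.\<close>
  have persist: "Q (Y j)" if "Q (Y i)" and "\<And>m. Q (Y m) \<Longrightarrow> Q (Y (Suc m))" for Q i j
  proof -
    have "Q (Y (i + m))" for m using that by (induction m) auto
    moreover have "i \<le> j + i * n" using n by (simp add: trans_le_add2)
    ultimately have "Q (Y (j + i * n))" by (metis le_Suc_ex)
    then show ?thesis by (simp add: period)
  qed
  define K where "K = (\<Inter>i. T i)"
  define C where "C = ucomponent K s"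
  define cut where "cut g \<longleftrightarrow> (fst g \<in> C) \<noteq> (snd g \<in> C)" for g
  have C_S: "C \<subseteq> S i" for i unfolding C_def S_def by (rule ucomponent_mono) (auto simp: K_def)
  have a_cut: "\<not> cut (a i)" for i
  proof
    assume cut: "cut (a i)"
    consider (U) "a i \<in> U (Suc i)" "fst (a i) \<in> S (Suc i)" "snd (a i) \<notin> S (Suc i)"
      | (L) "a i \<in> L (Suc i)" "fst (a i) \<notin> S (Suc i)" "snd (a i) \<in> S (Suc i)"
      using a_cross[of i] by (auto simp: residual_crossing_def)
    then show False
    proof cases
      case U
      \<comment> \<open>The head is outside \<open>S (Suc i)\<close>, hence outside
        \<open>C\<close>, so the cut arc has its tail in \<open>C\<close>. Entering from
        \<open>U\<close> needs a tail outside \<open>S m\<close>, which contains \<open>C\<close>;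
        thus \<open>a i\<close> stays in \<open>U\<close>.\<close>
      then have C: "fst (a i) \<in> C" using cut C_S unfolding cut_def by blast
      have "a i \<in> snd (snd (Y m)) \<Longrightarrow> a i \<in> snd (snd (Y (Suc m)))" for m
      proof -
        assume "a i \<in> snd (snd (Y m))"
        then have am: "a i \<in> U m" by (simp add: U_def)
        moreover have "a i \<noteq> e m"
          using e_cross[of m] am C C_S[of m] disj[of m] by (auto simp: residual_crossing_def)
        moreover have "a i \<noteq> a m" using calculation a[of m] disj[of m] by auto
        ultimately show ?thesis using U_Suc[of m] by (auto simp: U_def)
      qed
      then have "a i \<in> U i"
        using persist[of "\<lambda>y. a i \<in> snd (snd y)" "Suc i" i] U(1) by (simp add: U_def)
      \<comment> \<open>Being in \<open>U i\<close>, the leaving arc \<open>a i\<close> is not in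
        \<open>T i\<close>, so it equals \<open>e i\<close>; but its tail in \<open>C\<close>
        forbids entering.\<close>
      then show False
        using a[of i] e_cross[of i] disj[of i] C C_S[of i] by (auto simp: residual_crossing_def)
    next
      case L
      \<comment> \<open>Mirror image: entering from \<open>L\<close> needs a head outside
        \<open>S m\<close>.\<close>
      then have C: "snd (a i) \<in> C" using cut C_S unfolding cut_def by blast
      have "a i \<in> fst (snd (Y m)) \<Longrightarrow> a i \<in> fst (snd (Y (Suc m)))" for m
      proof -
        assume "a i \<in> fst (snd (Y m))"
        then have am: "a i \<in> L m" by (simp add: L_def)
        moreover have "a i \<noteq> e m"
          using e_cross[of m] am C C_S[of m] disj[of m] by (auto simp: residual_crossing_def)
        moreover have "a i \<noteq> a m" using calculation a[of m] disj[of m] by auto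
        ultimately show ?thesis using L_Suc[of m] by (auto simp: L_def)
      qed
      then have "a i \<in> L i"
        using persist[of "\<lambda>y. a i \<in> fst (snd y)" "Suc i" i] L(1) by (simp add: L_def)
      then show False
        using a[of i] e_cross[of i] disj[of i] C C_S[of i] by (auto simp: residual_crossing_def)
    qed
  qed
  have T_cut: "\<not> cut g" if "g \<in> T i" for g i
  proof
    assume g: "cut g"
    have "g \<in> T (Suc m)" if "g \<in> T m" for m using that T_Suc[of m] a_cut[of m] g by auto
    then have "g \<in> T j" for j
      using persist[of "\<lambda>y. g \<in> fst y" i j] \<open>g \<in> T i\<close> by (simp add: T_def)
    then have "g \<in> K" by (auto simp: K_def)
    then show False using g ucomponent_step[of g K s] by (simp add: cut_def C_def)
  qed
  \<comment> \<open>No arc of \<open>T 0\<close> leaves or enters \<open>C\<close>. With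
    \<open>C_S\<close> this gives \<open>S 0 = C\<close>, so the entering arc is cut.\<close>
  have "S 0 \<subseteq> C"
    unfolding S_def using T_cut[of _ 0]
    by (intro ucomponent_subset) (auto simp: cut_def C_def ucomponent_refl)
  then have e_cut: "cut (e 0)"
    using e_cross[of 0] C_S[of 0] by (auto simp: residual_crossing_def cut_def)
  then have "e 0 \<noteq> a 0" using a_cut[of 0] by metis
  then have "e 0 \<in> T (Suc 0)" unfolding T_Suc by blast
  then show False using T_cut e_cut by blast
qed

end
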